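(* Let $A$ and $E$ be real symmetric $n\times n$ matrices, $\tilde A=A+E$, where $A$ has rank $r<n$. Let $\lambda_1\ge\dots\ge\lambda_n$ be the eigenvalues of $A$ with a corresponding orthonormal basis of eigenvectors $u_1,\dots,u_n$, and let $\tilde\lambda_1\ge\dots\ge\tilde\lambda_n$ be the eigenvalues of $\tilde A$ with a corresponding orthonormal basis of eigenvectors $\tilde u_1,\dots,\tilde u_n$. Let $1\le p\le r$ be such that $\lambda_p>0$ and $\delta_p:=\lambda_p-\lambda_{p+1}>0$. Put $\Pi_p=\sum_{i=1}^p u_iu_i^T$ and $\tilde\Pi_p=\sum_{i=1}^p\tilde u_i\tilde u_i^T$. Let $x$, $y$, $w$ and $\|E\|_{A,p}=\sqrt r\,x+\sqrt r\,y$ be as defined in the context. Assume that $$\delta_p\ \ge\ \max\Big\{12\,r\,x,\ \frac{144\,r\,w^2}{\lambda_p}\Big\}.$$ Then $$\|\tilde\Pi_p-\Pi_p\|\ \le\ 12\sqrt p\,\frac{\|E\|_{A,p}}{\delta_p}+12\sqrt p\,\frac{\|E\|}{\lambda_p}.$$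
   Context: $\|\cdot\|$ is the spectral (operator) norm for matrices and the Euclidean norm for vectors. Let $I=\{i:\lambda_i\ne0\}$ be the set of indices of the nonzero eigenvalues of $A$, so $|I|=r$, and let $U_r$ be the $n\times r$ matrix whose columns are the $u_i$, $i\in I$. Define - $x:=\max_{i,j\in I}|u_i^TEu_j|$; - $y:=\max_{i,j\in I,\ i<j}\dfrac{|u_i^TE(I_n-U_rU_r^T)Eu_j|}{\lambda_p}$, where $I_n$ is the identity matrix (a maximum over an empty set is $0$); - $w:=\max_{i\in I}\|u_i^TE\|$. The relative norm is $\|E\|_{A,p}:=\sqrt r\,x+\sqrt r\,y$. *)

theory Defs
  imports "HOL-Analysis.Analysis"
begin

text \<open>The operator norm induced by the Euclidean norm. (The type class norm on
  \<open>real^'n^'n\<close> is the Frobenius norm, so it cannot be used here.)\<close>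

definition spectral_norm :: "real^'n^'m \<Rightarrow> real" where
  "spectral_norm M = onorm (\<lambda>v. M *v v)"

text \<open>The index range is \<open>1..n\<close> with \<open>n = CARD('n)\<close>; values of \<open>l\<close> and \<open>u\<close> outside it
  are irrelevant. Since \<open>n\<close> orthonormal vectors in dimension \<open>n\<close> form a basis, the list
  \<open>l 1, \<dots>, l n\<close> contains every eigenvalue with its multiplicity.\<close>

definition sorted_eigenbasis :: "real^'n^'n \<Rightarrow> (nat \<Rightarrow> real) \<Rightarrow> (nat \<Rightarrow> real^'n) \<Rightarrow> bool" where
  "sorted_eigenbasis M l u \<longleftrightarrow>
     (\<forall>i\<in>{1..CARD('n)}. \<forall>j\<in>{1..CARD('n)}. i \<le> j \<longrightarrow> l j \<le> l i) \<and>
     (\<forall>i\<in>{1..CARD('n)}. \<forall>j\<in>{1..CARD('n)}. u i \<bullet> u j = (if i = j then 1 else 0)) \<and>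
     (\<forall>i\<in>{1..CARD('n)}. M *v u i = l i *\<^sub>R u i)"

definition outer :: "real^'n \<Rightarrow> real^'n \<Rightarrow> real^'n^'n" where
  "outer v w = (\<chi> a b. v $ a * w $ b)"

definition spectral_proj :: "(nat \<Rightarrow> real^'n) \<Rightarrow> nat \<Rightarrow> real^'n^'n" where
  "spectral_proj u p = (\<Sum>i=1..p. outer (u i) (u i))"

definition nonzero_idx :: "'n itself \<Rightarrow> (nat \<Rightarrow> real) \<Rightarrow> nat set" where
  "nonzero_idx _ l = {i \<in> {1..CARD('n)}. l i \<noteq> 0}"

text \<open>The product \<open>U * U\<^sup>T\<close>, written out entrywise, where \<open>U\<close> has the columns \<open>u i\<close> for \<open>i\<close>
  in \<open>S\<close>. The size of \<open>S\<close> is not a type, so \<open>U\<close> itself is not a matrix over a finite type.\<close>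

definition gram_cols :: "(nat \<Rightarrow> real^'n) \<Rightarrow> nat set \<Rightarrow> real^'n^'n" where
  "gram_cols u S = (\<chi> a b. \<Sum>i\<in>S. u i $ a * u i $ b)"

definition max0 :: "real set \<Rightarrow> real" where
  "max0 S = (if S = {} then 0 else Max S)"

definition pert_x :: "real^'n^'n \<Rightarrow> (nat \<Rightarrow> real) \<Rightarrow> (nat \<Rightarrow> real^'n) \<Rightarrow> real" where
  "pert_x E l u =
     max0 {\<bar>u i \<bullet> (E *v u j)\<bar> | i j. i \<in> nonzero_idx TYPE('n) l \<and> j \<in> nonzero_idx TYPE('n) l}"

definition pert_y :: "real^'n^'n \<Rightarrow> (nat \<Rightarrow> real) \<Rightarrow> (nat \<Rightarrow> real^'n) \<Rightarrow> nat \<Rightarrow> real" where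
  "pert_y E l u p =
     max0 {\<bar>u i \<bullet> ((E ** (mat 1 - gram_cols u (nonzero_idx TYPE('n) l)) ** E) *v u j)\<bar> / l p | i j.
             i \<in> nonzero_idx TYPE('n) l \<and> j \<in> nonzero_idx TYPE('n) l \<and> i < j}"

definition pert_w :: "real^'n^'n \<Rightarrow> (nat \<Rightarrow> real) \<Rightarrow> (nat \<Rightarrow> real^'n) \<Rightarrow> real" where
  "pert_w E l u = max0 {norm (u i v* E) | i. i \<in> nonzero_idx TYPE('n) l}"

definition rel_norm ::
    "real^'n^'n \<Rightarrow> real^'n^'n \<Rightarrow> (nat \<Rightarrow> real) \<Rightarrow> (nat \<Rightarrow> real^'n) \<Rightarrow> nat \<Rightarrow> real" where
  "rel_norm A E l u p = sqrt (real (rank A)) * pert_x E l u + sqrt (real (rank A)) * pert_y E l u p"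

end

theory Submission
  imports Defs
begin

text \<open>
  Write \<open>\<epsilon>\<close> for the operator norm of \<open>E\<close>, \<open>G\<close> for the orthogonal projection onto the range
  of \<open>A\<close> (the span of the \<open>u i\<close> with \<open>l i \<noteq> 0\<close>), and \<open>Q = 1 - G\<close>. The bound is a residual
  argument in the style of Davis and Kahan: if \<open>v\<close> is an approximate eigenvector of \<open>A + E\<close> for
  some \<open>\<mu>\<close> that exceeds \<open>l' (p + 1)\<close> by \<open>g\<close>, then \<open>v\<close> has distance at most
  \<open>\<parallel>(A + E) v - \<mu> v\<parallel> / g\<close> from the span of \<open>u' 1, \<dots>, u' p\<close>
  (\<open>eigenspace_residual_bound\<close>).

  The test vector \<open>v = u i\<close> is too crude. Its residual is \<open>E (u i)\<close>, of which \<open>G E (u i)\<close> is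
  controlled by \<open>x\<close>, but \<open>Q E (u i)\<close> may be as large as \<open>w\<close> and would be divided by \<open>\<delta>\<close>.
  The remedy is to correct \<open>u i\<close> by the solution \<open>z\<close> of \<open>(l i - Q E Q) z = Q E (u i)\<close>, which
  lies in the kernel of \<open>A\<close> and cancels the component of the residual there. The correction is
  of size \<open>\<epsilon> / l p\<close>, and this is where the second term of the bound comes from. What it leaves
  behind is \<open>G E z\<close>, to leading order \<open>G E Q E (u i) / l i\<close>. The off-diagonal coordinates of
  this vector are what \<open>y\<close> measures. The diagonal coordinate is not controlled by \<open>y\<close>, but it
  is \<open>\<parallel>Q E (u i)\<parallel>\<^sup>2 / l i \<ge> 0\<close> and is absorbed by raising the approximate eigenvalue from \<open>l i\<close>
  by this amount, which only widens the gap. All further terms are of order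
  \<open>r w\<^sup>2 \<epsilon> / (l p)\<^sup>2 \<le> \<delta> \<epsilon> / (144 l p)\<close>. This is \<open>corrected_eigenvector\<close>.

  The gap itself survives the perturbation: on the orthogonal complement of \<open>u 1, \<dots>, u p\<close> the
  quadratic form of \<open>A + E\<close> is at most \<open>l p - 3/4 * \<delta>\<close>, by splitting a vector into its parts in
  the range and in the kernel of \<open>A\<close> (\<open>quadratic_form_complement_le\<close>), and a dimension count
  turns this into \<open>l' (p + 1) \<le> l p - 3/4 * \<delta>\<close> (\<open>eigenvalue_upper_bound\<close>). This needs \<open>\<epsilon>\<close> to be
  small against \<open>l p\<close>; for \<open>6 * \<epsilon> > l p\<close> the claimed bound exceeds 2 and holds trivially.

  Finally, distances at most \<open>s\<close> of \<open>u 1, \<dots>, u p\<close> from the span of \<open>u' 1, \<dots>, u' p\<close> bound the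
  difference of the two projections by \<open>2 * sqrt p * s\<close> (\<open>spectral_norm_proj_diff_le\<close>).
\<close>

section \<open>Orthogonal projections onto the span of an orthonormal family\<close>

text \<open>Finiteness of the index set follows from orthonormality in a finite-dimensional space; as part
  of the definition it makes the sums over \<open>S\<close> meaningful from the start.\<close>

definition orthonormal_on :: "nat set \<Rightarrow> (nat \<Rightarrow> real^'n) \<Rightarrow> bool" where
  "orthonormal_on S u \<longleftrightarrow> finite S \<and> (\<forall>i\<in>S. \<forall>j\<in>S. u i \<bullet> u j = (if i = j then 1 else 0))"

lemma orthonormal_on_subset: "orthonormal_on T u \<Longrightarrow> S \<subseteq> T \<Longrightarrow> orthonormal_on S u"
  unfolding orthonormal_on_def by (meson finite_subset subsetD)

lemma norm_orthonormal: "orthonormal_on S u \<Longrightarrow> i \<in> S \<Longrightarrow> norm (u i) = 1"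
  by (simp add: orthonormal_on_def norm_eq_1)

text \<open>For an orthonormal family, \<open>gram_cols u S\<close> is the orthogonal projection onto the span of
  the \<open>u i\<close> with \<open>i\<close> in \<open>S\<close>; it is used below both for \<open>U\<^sub>r U\<^sub>r\<^sup>T\<close> and for the spectral
  projections.\<close>

lemma gram_cols_mult: "gram_cols u S *v v = (\<Sum>i\<in>S. (u i \<bullet> v) *\<^sub>R u i)"
proof -
  have "(\<Sum>b\<in>UNIV. (\<Sum>i\<in>S. u i $ a * u i $ b) * v $ b) = (\<Sum>i\<in>S. (\<Sum>b\<in>UNIV. u i $ b * v $ b) * u i $ a)" for a
    unfolding sum_distrib_right by (subst sum.swap) (simp add: mult_ac)
  then show ?thesis
    by (simp add: gram_cols_def matrix_vector_mult_def inner_vec_def vec_eq_iff)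
qed

lemma spectral_proj_eq_gram_cols: "spectral_proj u p = gram_cols u {1..p}"
  by (simp add: spectral_proj_def gram_cols_def outer_def vec_eq_iff)

lemma gram_cols_symmetric: "(gram_cols u S *v v) \<bullet> w = v \<bullet> (gram_cols u S *v w)"
  by (simp add: gram_cols_mult inner_sum_left inner_sum_right inner_commute mult.commute)

lemma inner_gram_cols:
  assumes "orthonormal_on S u" "i \<in> S"
  shows "u i \<bullet> (gram_cols u S *v v) = u i \<bullet> v"
proof -
  have "u i \<bullet> (gram_cols u S *v v) = (\<Sum>j\<in>S. if i = j then u j \<bullet> v else 0)"
    unfolding gram_cols_mult inner_sum_right
    by (rule sum.cong) (use assms in \<open>auto simp: orthonormal_on_def\<close>)
  then show ?thesis using assms by (simp add: orthonormal_on_def)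
qed

lemma gram_cols_fix: "orthonormal_on S u \<Longrightarrow> i \<in> S \<Longrightarrow> gram_cols u S *v u i = u i"
proof -
  assume a: "orthonormal_on S u" "i \<in> S"
  have "gram_cols u S *v u i = (\<Sum>j\<in>S. if i = j then u j else 0)"
    unfolding gram_cols_mult
    by (rule sum.cong) (use a in \<open>auto simp: orthonormal_on_def\<close>)
  then show ?thesis using a by (simp add: orthonormal_on_def)
qed

lemma gram_cols_idem:
  assumes "orthonormal_on S u"
  shows "gram_cols u S *v (gram_cols u S *v v) = gram_cols u S *v v"
  by (simp add: gram_cols_mult[of u S "gram_cols u S *v v"] inner_gram_cols[OF assms]
      gram_cols_mult[symmetric])

lemma norm_gram_cols:
  assumes "orthonormal_on S u"
  shows "(norm (gram_cols u S *v v))\<^sup>2 = (\<Sum>i\<in>S. (u i \<bullet> v)\<^sup>2)"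
proof -
  have "(norm (gram_cols u S *v v))\<^sup>2 = v \<bullet> (gram_cols u S *v v)"
    by (simp add: power2_norm_eq_inner gram_cols_symmetric gram_cols_idem[OF assms])
  then show ?thesis
    by (simp add: gram_cols_mult inner_sum_right power2_eq_square inner_commute)
qed

lemma gram_cols_pythagoras:
  assumes "orthonormal_on S u"
  shows "(norm v)\<^sup>2 = (norm (gram_cols u S *v v))\<^sup>2 + (norm (v - gram_cols u S *v v))\<^sup>2"
proof -
  have "(gram_cols u S *v v) \<bullet> (v - gram_cols u S *v v) = 0"
    by (simp add: gram_cols_symmetric matrix_vector_mult_diff_distrib gram_cols_idem[OF assms])
  then show ?thesis
    by (simp add: power2_norm_eq_inner inner_diff_left inner_diff_right inner_commute)
qed

lemma norm_gram_cols_le: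
  assumes "orthonormal_on S u"
  shows "norm (gram_cols u S *v v) \<le> norm v" "norm (v - gram_cols u S *v v) \<le> norm v"
  by (rule power2_le_imp_le, simp add: gram_cols_pythagoras[OF assms, of v], simp)+

text \<open>The source of every factor \<open>sqrt r\<close>: a vector with \<open>r\<close> coordinates of size at most \<open>c\<close>
  has norm at most \<open>sqrt r * c\<close>.\<close>

lemma norm_gram_cols_le_coeffs:
  assumes "orthonormal_on S u" "0 \<le> c" "\<And>i. i \<in> S \<Longrightarrow> \<bar>u i \<bullet> v\<bar> \<le> c"
  shows "norm (gram_cols u S *v v) \<le> sqrt (real (card S)) * c"
proof -
  have "(\<Sum>i\<in>S. (u i \<bullet> v)\<^sup>2) \<le> (\<Sum>i\<in>S. c\<^sup>2)"
    by (rule sum_mono) (metis assms(3) abs_ge_zero power2_abs power_mono)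
  then have "(norm (gram_cols u S *v v))\<^sup>2 \<le> (sqrt (real (card S)) * c)\<^sup>2"
    by (simp add: norm_gram_cols[OF assms(1)] power_mult_distrib)
  then show ?thesis by (rule power2_le_imp_le) (simp add: assms(2))
qed

lemma orthonormal_independent:
  assumes "orthonormal_on S u"
  shows "independent (u ` S)" "card (u ` S) = card S"
proof -
  have "0 \<notin> u ` S" using assms by (force simp: orthonormal_on_def)
  moreover have "pairwise orthogonal (u ` S)"
    using assms by (auto simp: pairwise_def orthogonal_def orthonormal_on_def)
  ultimately show "independent (u ` S)" by (rule pairwise_orthogonal_independent[rotated])
  have "inj_on u S" using assms unfolding orthonormal_on_def inj_on_def
    by (metis zero_neq_one)
  then show "card (u ` S) = card S" by (rule card_image)
qed

lemma dim_orthonormal: "orthonormal_on S u \<Longrightarrow> dim (u ` S) = card S"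
  using orthonormal_independent[of S u] by (simp add: dim_eq_card_independent)

lemma gram_cols_basis:
  fixes u :: "nat \<Rightarrow> real^'n"
  assumes "orthonormal_on {1..CARD('n)} u"
  shows "gram_cols u {1..CARD('n)} *v v = v"
proof -
  let ?S = "{1..CARD('n)}" and ?d = "v - gram_cols u {1..CARD('n)} *v v"
  have "dim (u ` ?S) = DIM(real^'n)" using dim_orthonormal[OF assms] by simp
  then have "span (u ` ?S) = UNIV" by (simp only: dim_eq_full)
  moreover have "orthogonal ?d y" if "y \<in> u ` ?S" for y
  proof -
    from that obtain i where "i \<in> ?S" "y = u i" by blast
    then have "y \<bullet> ?d = 0" using inner_gram_cols[OF assms, of i v] by (simp only: inner_diff_right)
    then show ?thesis by (simp add: orthogonal_def inner_commute)
  qed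
  ultimately have "orthogonal ?d ?d" by (intro orthogonal_to_span[of ?d "u ` ?S"]) simp_all
  then show ?thesis by (simp add: orthogonal_self)
qed

lemma parseval:
  fixes u :: "nat \<Rightarrow> real^'n"
  assumes "orthonormal_on {1..CARD('n)} u"
  shows "(norm v)\<^sup>2 = (\<Sum>i=1..CARD('n). (u i \<bullet> v)\<^sup>2)"
  using norm_gram_cols[OF assms, of v] unfolding gram_cols_basis[OF assms] .

section \<open>Symmetric matrices and their eigenbases\<close>

lemma symmetric_matrix_inner:
  fixes M :: "real^'n^'n"
  assumes "transpose M = M"
  shows "(M *v a) \<bullet> b = a \<bullet> (M *v b)"
  by (metis assms dot_lmul_matrix transpose_matrix_vector)

lemma sorted_eigenbasisD:
  fixes M :: "real^'n^'n"
  assumes "sorted_eigenbasis M l u"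
  shows "orthonormal_on {1..CARD('n)} u"
    and "\<And>i j. 1 \<le> i \<Longrightarrow> i \<le> j \<Longrightarrow> j \<le> CARD('n) \<Longrightarrow> l j \<le> l i"
    and "\<And>i. i \<in> {1..CARD('n)} \<Longrightarrow> M *v u i = l i *\<^sub>R u i"
  using assms unfolding sorted_eigenbasis_def orthonormal_on_def by auto

lemma eigenbasis_mult:
  fixes M :: "real^'n^'n"
  assumes "sorted_eigenbasis M l u"
  shows "M *v v = (\<Sum>i=1..CARD('n). (l i * (u i \<bullet> v)) *\<^sub>R u i)"
proof -
  have "M *v v = M *v (\<Sum>i=1..CARD('n). (u i \<bullet> v) *\<^sub>R u i)"
    by (metis gram_cols_basis gram_cols_mult sorted_eigenbasisD(1)[OF assms])
  also have "\<dots> = (\<Sum>i=1..CARD('n). (u i \<bullet> v) *\<^sub>R (M *v u i))"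
    by (simp add: vec.sum matrix_vector_mult_scaleR)
  also have "\<dots> = (\<Sum>i=1..CARD('n). (l i * (u i \<bullet> v)) *\<^sub>R u i)"
    by (rule sum.cong) (simp_all add: sorted_eigenbasisD(3)[OF assms])
  finally show ?thesis .
qed

lemma eigenbasis_quadratic_form:
  fixes M :: "real^'n^'n"
  assumes "sorted_eigenbasis M l u"
  shows "v \<bullet> (M *v v) = (\<Sum>i=1..CARD('n). l i * (u i \<bullet> v)\<^sup>2)"
  unfolding eigenbasis_mult[OF assms] inner_sum_right
  by (rule sum.cong) (simp_all add: power2_eq_square inner_commute)

lemma eigenbasis_coeff_mult:
  fixes M :: "real^'n^'n"
  assumes "sorted_eigenbasis M l u" "i \<in> {1..CARD('n)}"
  shows "u i \<bullet> (M *v v) = l i * (u i \<bullet> v)"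
proof -
  have "u i \<bullet> (M *v v) = (\<Sum>j=1..CARD('n). if i = j then l j * (u j \<bullet> v) else 0)"
    unfolding eigenbasis_mult[OF assms(1)] inner_sum_right
    by (rule sum.cong) (use assms in \<open>auto simp: sorted_eigenbasis_def\<close>)
  then show ?thesis using assms(2) by simp
qed

text \<open>One half of the Courant-Fischer principle. The span of \<open>u' 1, \<dots>, u' (p + 1)\<close> has dimension
  \<open>p + 1\<close>, so the map \<open>gram_cols u {1..p}\<close>, of rank at most \<open>p\<close>, kills a nonzero vector in it,
  and on that span the quadratic form is at least \<open>l' (p + 1)\<close>.\<close>

lemma eigenvalue_upper_bound:
  fixes M :: "real^'n^'n" and u :: "nat \<Rightarrow> real^'n"
  assumes M: "sorted_eigenbasis M l' u'" and p: "p < CARD('n)"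
    and bound: "\<And>v. gram_cols u {1..p} *v v = 0 \<Longrightarrow> v \<bullet> (M *v v) \<le> c * (norm v)\<^sup>2"
  shows "l' (p + 1) \<le> c"
proof -
  note on = sorted_eigenbasisD(1)[OF M]
  let ?S = "span (u' ` {1..p+1})"
  let ?G = "(*v) (gram_cols u {1..p})"
  have on1: "orthonormal_on {1..p+1} u'" by (rule orthonormal_on_subset[OF on]) (use p in auto)
  have "\<not> inj_on ?G ?S"
  proof
    assume "inj_on ?G ?S"
    then have "dim (?G ` (u' ` {1..p+1})) = p + 1"
      using dim_orthonormal[OF on1] by (subst dim_image_eq) simp_all
    moreover have "?G ` (u' ` {1..p+1}) \<subseteq> span (u ` {1..p})"
      by (auto simp: gram_cols_mult intro!: span_sum span_scale intro: span_base)
    then have "dim (?G ` (u' ` {1..p+1})) \<le> dim (span (u ` {1..p}))" by (rule dim_subset)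
    moreover have "dim (span (u ` {1..p})) \<le> p"
      using dim_le_card'[of "u ` {1..p}"] card_image_le[of "{1..p}" u] by simp
    ultimately show False by simp
  qed
  then obtain a b where ab: "a \<in> ?S" "b \<in> ?S" "?G a = ?G b" "a \<noteq> b"
    by (auto simp: inj_on_def)
  define v where "v = a - b"
  have v: "v \<in> ?S" "v \<noteq> 0" "?G v = 0"
    using ab by (simp_all add: v_def span_diff matrix_vector_mult_diff_distrib)
  have out: "u' j \<bullet> v = 0" if j: "j \<in> {1..CARD('n)}" "j > p + 1" for j
  proof -
    have "orthogonal (u' j) v"
      by (rule orthogonal_to_span[OF v(1)])
        (use on j p in \<open>auto simp: orthonormal_on_def orthogonal_def\<close>)
    then show ?thesis by (simp add: orthogonal_def)
  qed
  have "l' (p+1) * (norm v)\<^sup>2 = (\<Sum>i=1..CARD('n). l' (p+1) * (u' i \<bullet> v)\<^sup>2)"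
    by (simp add: parseval[OF on] sum_distrib_left)
  also have "\<dots> \<le> (\<Sum>i=1..CARD('n). l' i * (u' i \<bullet> v)\<^sup>2)"
  proof (rule sum_mono)
    fix i assume i: "i \<in> {1..CARD('n)}"
    show "l' (p+1) * (u' i \<bullet> v)\<^sup>2 \<le> l' i * (u' i \<bullet> v)\<^sup>2"
    proof (cases "i \<le> p + 1")
      case True
      then show ?thesis using i p sorted_eigenbasisD(2)[OF M, of i "p+1"]
        by (intro mult_right_mono) auto
    next
      case False
      then show ?thesis using out[of i] i by simp
    qed
  qed
  also have "\<dots> = v \<bullet> (M *v v)" by (rule eigenbasis_quadratic_form[OF M, symmetric])
  also have "\<dots> \<le> c * (norm v)\<^sup>2" by (rule bound) (rule v(3))
  finally show ?thesis using v(2) by simp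
qed

text \<open>In the eigenbasis, \<open>M - \<mu>\<close> multiplies each coordinate beyond the \<open>p\<close>-th by a factor of
  absolute value at least \<open>g\<close>, and these coordinates make up the distance of \<open>v\<close> from the span of
  the first \<open>p\<close> eigenvectors.\<close>

lemma eigenspace_residual_bound:
  fixes M :: "real^'n^'n"
  assumes M: "sorted_eigenbasis M l u" and p: "p \<le> CARD('n)" and gap: "0 < g" "l (p + 1) + g \<le> \<mu>"
  shows "norm (v - gram_cols u {1..p} *v v) \<le> norm (M *v v - \<mu> *\<^sub>R v) / g"
proof -
  note on = sorted_eigenbasisD(1)[OF M]
  have sub: "{1..p} \<subseteq> {1..CARD('n)}" using p by auto
  let ?P = "gram_cols u {1..p} *v v"
  have "(norm (g *\<^sub>R (v - ?P)))\<^sup>2 = g\<^sup>2 * (\<Sum>i\<in>{p+1..CARD('n)}. (u i \<bullet> v)\<^sup>2)"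
  proof -
    have "(norm (v - ?P))\<^sup>2 = (\<Sum>i=1..CARD('n). (u i \<bullet> v)\<^sup>2) - (\<Sum>i=1..p. (u i \<bullet> v)\<^sup>2)"
      using gram_cols_pythagoras[OF orthonormal_on_subset[OF on sub], of v]
      unfolding parseval[OF on, of v] norm_gram_cols[OF orthonormal_on_subset[OF on sub]] by simp
    also have "\<dots> = (\<Sum>i\<in>{1..CARD('n)} - {1..p}. (u i \<bullet> v)\<^sup>2)"
      using sub by (simp add: sum_diff)
    also have "{1..CARD('n)} - {1..p} = {p+1..CARD('n)}" by auto
    finally show ?thesis by (simp add: power_mult_distrib)
  qed
  also have "\<dots> \<le> (\<Sum>i\<in>{p+1..CARD('n)}. (u i \<bullet> (M *v v - \<mu> *\<^sub>R v))\<^sup>2)"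
    unfolding sum_distrib_left
  proof (rule sum_mono)
    fix i assume i: "i \<in> {p+1..CARD('n)}"
    have "l i \<le> l (p+1)" using i by (intro sorted_eigenbasisD(2)[OF M]) auto
    then have "g\<^sup>2 \<le> (\<mu> - l i)\<^sup>2" using gap by (intro power_mono) auto
    moreover have "u i \<bullet> (M *v v - \<mu> *\<^sub>R v) = - ((\<mu> - l i) * (u i \<bullet> v))"
      using i by (simp add: inner_diff_right eigenbasis_coeff_mult[OF M] algebra_simps)
    ultimately show "g\<^sup>2 * (u i \<bullet> v)\<^sup>2 \<le> (u i \<bullet> (M *v v - \<mu> *\<^sub>R v))\<^sup>2"
      by (simp add: power_mult_distrib mult_right_mono)
  qed
  also have "\<dots> \<le> (\<Sum>i=1..CARD('n). (u i \<bullet> (M *v v - \<mu> *\<^sub>R v))\<^sup>2)"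
    by (rule sum_mono2) auto
  also have "\<dots> = (norm (M *v v - \<mu> *\<^sub>R v))\<^sup>2" by (rule parseval[OF on, symmetric])
  finally have "norm (g *\<^sub>R (v - ?P)) \<le> norm (M *v v - \<mu> *\<^sub>R v)"
    by (rule power2_le_imp_le) simp
  then have "g * norm (v - ?P) \<le> norm (M *v v - \<mu> *\<^sub>R v)" using gap by (simp only: norm_scaleR)
  then show ?thesis using gap by (simp add: pos_le_divide_eq mult.commute)
qed

section \<open>Comparing two orthogonal projections of equal rank\<close>

lemma norm_spectral_norm: "norm (M *v v) \<le> spectral_norm M * norm v"
  unfolding spectral_norm_def by (rule onorm) (rule matrix_vector_mul_bounded_linear)

lemma spectral_norm_nonneg: "0 \<le> spectral_norm M"
  unfolding spectral_norm_def by (rule onorm_pos_le) (rule matrix_vector_mul_bounded_linear)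

lemma spectral_norm_le:
  fixes M :: "real^'n^'m"
  assumes "\<And>v. norm (M *v v) \<le> c * norm v" 
  shows "spectral_norm M \<le> c"
  unfolding spectral_norm_def
proof (rule onorm_bound)
  obtain v :: "real^'n" where "norm v = 1" by (meson norm_axis_1)
  then show "0 \<le> c" using order_trans[OF norm_ge_zero assms, of v] by simp
qed (rule assms)

text \<open>Both sides equal the common cardinality minus the sum of all \<open>(u i \<bullet> v j)\<^sup>2\<close>. This is what
  allows a bound on how far one space sticks out of the other to be used in both directions.\<close>

lemma proj_leakage_symmetric:
  assumes "orthonormal_on S u" "orthonormal_on T v" "card S = card T"
  shows "(\<Sum>i\<in>S. (norm (u i - gram_cols v T *v u i))\<^sup>2) = (\<Sum>j\<in>T. (norm (v j - gram_cols u S *v v j))\<^sup>2)"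
proof -
  have leak: "(\<Sum>i\<in>S. (norm (u i - gram_cols v T *v u i))\<^sup>2) = card S - (\<Sum>i\<in>S. \<Sum>j\<in>T. (v j \<bullet> u i)\<^sup>2)"
    if "orthonormal_on S u" "orthonormal_on T v" for S T and u v :: "nat \<Rightarrow> real^'a"
  proof -
    have "(norm (u i - gram_cols v T *v u i))\<^sup>2 = 1 - (\<Sum>j\<in>T. (v j \<bullet> u i)\<^sup>2)" if "i \<in> S" for i
      using gram_cols_pythagoras[OF \<open>orthonormal_on T v\<close>, of "u i"]
        norm_gram_cols[OF \<open>orthonormal_on T v\<close>, of "u i"]
        norm_orthonormal[OF \<open>orthonormal_on S u\<close> that] by simp
    then show ?thesis by (simp add: sum_subtractf)
  qed
  show ?thesis unfolding leak[OF assms(1,2)] leak[OF assms(2,1)] assms(3)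
    by (subst sum.swap) (simp add: inner_commute)
qed

text \<open>The Frobenius norm of \<open>(1 - P\<^sub>v) P\<^sub>u\<close> bounds its operator norm, by the Cauchy-Schwarz
  inequality.\<close>

lemma norm_proj_leakage_le:
  assumes "orthonormal_on S u"
  shows "norm (gram_cols u S *v x - gram_cols v T *v (gram_cols u S *v x))
      \<le> sqrt (\<Sum>i\<in>S. (norm (u i - gram_cols v T *v u i))\<^sup>2) * norm x"
proof -
  let ?G = "gram_cols v T"
  have "gram_cols u S *v x - ?G *v (gram_cols u S *v x) = (\<Sum>i\<in>S. (u i \<bullet> x) *\<^sub>R (u i - ?G *v u i))"
    by (simp add: gram_cols_mult[of u S] vec.sum matrix_vector_mult_scaleR sum_subtractf
        scaleR_diff_right)
  then have "norm (gram_cols u S *v x - ?G *v (gram_cols u S *v x))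
      \<le> (\<Sum>i\<in>S. \<bar>u i \<bullet> x\<bar> * \<bar>norm (u i - ?G *v u i)\<bar>)"
    by (metis (mono_tags, lifting) abs_norm_cancel norm_scaleR norm_sum sum.cong)
  also have "\<dots> \<le> L2_set (\<lambda>i. u i \<bullet> x) S * L2_set (\<lambda>i. norm (u i - ?G *v u i)) S"
    by (rule L2_set_mult_ineq)
  also have "L2_set (\<lambda>i. u i \<bullet> x) S = norm (gram_cols u S *v x)"
    by (simp add: L2_set_def norm_gram_cols[OF assms, symmetric])
  also have "\<dots> * L2_set (\<lambda>i. norm (u i - ?G *v u i)) S \<le> norm x * L2_set (\<lambda>i. norm (u i - ?G *v u i)) S"
    by (intro mult_right_mono norm_gram_cols_le(1)[OF assms] L2_set_nonneg)
  finally show ?thesis by (simp add: L2_set_def mult.commute)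
qed

lemma spectral_norm_proj_diff_le_2:
  assumes "orthonormal_on S u" "orthonormal_on T v"
  shows "spectral_norm (gram_cols v T - gram_cols u S) \<le> 2"
proof (rule spectral_norm_le)
  fix x
  show "norm ((gram_cols v T - gram_cols u S) *v x) \<le> 2 * norm x"
    using norm_triangle_ineq4[of "gram_cols v T *v x" "gram_cols u S *v x"]
      norm_gram_cols_le(1)[OF assms(1), of x] norm_gram_cols_le(1)[OF assms(2), of x]
    by (simp add: matrix_vector_mult_diff_rdistrib)
qed

text \<open>With \<open>P\<close> and \<open>P'\<close> the two projections, \<open>P' - P = P' (1 - P) - (1 - P') P\<close>. The second summand
  is the leakage of \<open>P\<close> out of \<open>P'\<close>. The first is the transpose of the leakage \<open>(1 - P) P'\<close> of
  \<open>P'\<close> out of \<open>P\<close>, which has the same Frobenius norm because the ranks agree.\<close>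

lemma spectral_norm_proj_diff_le:
  fixes u v :: "nat \<Rightarrow> real^'n"
  assumes u: "orthonormal_on S u" and v: "orthonormal_on T v" and card: "card S = card T"
    and s: "0 \<le> s" "\<And>i. i \<in> S \<Longrightarrow> norm (u i - gram_cols v T *v u i) \<le> s"
  shows "spectral_norm (gram_cols v T - gram_cols u S) \<le> 2 * (sqrt (card S) * s)"
proof (rule spectral_norm_le)
  fix x :: "real^'n"
  let ?P = "gram_cols u S" and ?Q = "gram_cols v T"
  define F where "F = sqrt (\<Sum>i\<in>S. (norm (u i - gram_cols v T *v u i))\<^sup>2)"
  have F': "F = sqrt (\<Sum>j\<in>T. (norm (v j - ?P *v v j))\<^sup>2)"
    unfolding F_def by (subst proj_leakage_symmetric[OF u v card]) (rule refl)
  have F0: "0 \<le> F" by (simp add: F_def sum_nonneg)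
  have "(\<Sum>i\<in>S. (norm (u i - ?Q *v u i))\<^sup>2) \<le> (\<Sum>i\<in>S. s\<^sup>2)"
    by (intro sum_mono power_mono s) auto
  then have "F\<^sup>2 \<le> (sqrt (card S) * s)\<^sup>2"
    by (simp add: F_def power_mult_distrib sum_nonneg)
  then have Fs: "F \<le> sqrt (card S) * s" by (rule power2_le_imp_le) (simp add: s)
  define y where "y = x - ?P *v x"
  define z where "z = ?Q *v y"
  have zQ: "?Q *v z = z" by (simp add: z_def gram_cols_idem[OF v])
  have Py: "?P *v y = 0"
    by (simp add: y_def matrix_vector_mult_diff_distrib gram_cols_idem[OF u])
  have "(norm z)\<^sup>2 = z \<bullet> y"
    by (metis gram_cols_symmetric power2_norm_eq_inner zQ z_def)
  also have "\<dots> = (z - ?P *v z) \<bullet> y"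
    by (simp add: inner_diff_left gram_cols_symmetric Py)
  also have "\<dots> \<le> norm (z - ?P *v z) * norm y" by (rule norm_cauchy_schwarz)
  also have "\<dots> \<le> (F * norm z) * norm y"
    using norm_proj_leakage_le[OF v, of z u S] by (intro mult_right_mono) (auto simp: F' zQ)
  finally have "norm z * norm z \<le> norm z * (F * norm y)"
    by (simp add: power2_eq_square mult_ac)
  then have "norm z \<le> F * norm y"
    using F0 by (cases "z = 0") (auto simp: mult_le_cancel_left_pos)
  also have "\<dots> \<le> F * norm x"
    unfolding y_def by (intro mult_left_mono norm_gram_cols_le(2)[OF u] F0)
  finally have z: "norm z \<le> F * norm x" .
  have split: "(?Q - ?P) *v x = z - (?P *v x - ?Q *v (?P *v x))"
    by (simp add: z_def y_def matrix_vector_mult_diff_distrib matrix_vector_mult_diff_rdistrib)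
  have leak: "norm (?P *v x - ?Q *v (?P *v x)) \<le> F * norm x"
    unfolding F_def by (rule norm_proj_leakage_le[OF u])
  have "norm ((?Q - ?P) *v x) \<le> norm z + norm (?P *v x - ?Q *v (?P *v x))"
    unfolding split by (rule norm_triangle_ineq4)
  also have "\<dots> \<le> 2 * (F * norm x)" using z leak by linarith
  also have "\<dots> \<le> 2 * (sqrt (card S) * s) * norm x"
    using mult_right_mono[OF Fs norm_ge_zero[of x]] by linarith
  finally show "norm ((?Q - ?P) *v x) \<le> 2 * (sqrt (card S) * s) * norm x" .
qed

section \<open>The nonzero eigenvalues\<close>

lemma nonzero_idx_orthonormal:
  fixes A :: "real^'n^'n"
  assumes "sorted_eigenbasis A l u"
  shows "orthonormal_on (nonzero_idx TYPE('n) l) u"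
  by (rule orthonormal_on_subset[OF sorted_eigenbasisD(1)[OF assms]]) (auto simp: nonzero_idx_def)

lemma eigenbasis_mult_nonzero_idx:
  fixes A :: "real^'n^'n"
  assumes "sorted_eigenbasis A l u"
  shows "A *v v = (\<Sum>i\<in>nonzero_idx TYPE('n) l. (l i * (u i \<bullet> v)) *\<^sub>R u i)"
  unfolding eigenbasis_mult[OF assms]
  by (rule sum.mono_neutral_right) (auto simp: nonzero_idx_def)

lemma rank_eq_card_nonzero_idx:
  fixes A :: "real^'n^'n"
  assumes A: "sorted_eigenbasis A l u"
  shows "rank A = card (nonzero_idx TYPE('n) l)"
proof -
  let ?I = "nonzero_idx TYPE('n) l"
  note dim = dim_orthonormal[OF nonzero_idx_orthonormal[OF A]]
  have "u i \<in> range ((*v) A)" if "i \<in> ?I" for i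
    using that sorted_eigenbasisD(3)[OF A, of i]
    by (intro range_eqI[of _ _ "(1 / l i) *\<^sub>R u i"])
       (auto simp: nonzero_idx_def matrix_vector_mult_scaleR)
  then have "dim (u ` ?I) \<le> dim (range ((*v) A))" by (intro dim_subset) auto
  moreover have "range ((*v) A) \<subseteq> span (u ` ?I)"
    by (auto simp: eigenbasis_mult_nonzero_idx[OF A] intro!: span_sum span_scale intro: span_base)
  then have "dim (range ((*v) A)) \<le> dim (span (u ` ?I))" by (rule dim_subset)
  ultimately show ?thesis by (simp add: rank_dim_range dim)
qed

text \<open>Since \<open>A\<close> is singular, 0 occurs among the eigenvalues, and it occurs after the positive
  \<open>l p\<close>. Hence the gap \<open>l p - l (p + 1)\<close> is at most \<open>l p\<close>.\<close>

lemma next_eigenvalue_nonneg: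
  fixes A :: "real^'n^'n"
  assumes A: "sorted_eigenbasis A l u" and "rank A < CARD('n)" and "1 \<le> p" "p < CARD('n)" "0 < l p"
  shows "0 \<le> l (p + 1)"
proof -
  have "nonzero_idx TYPE('n) l \<noteq> {1..CARD('n)}"
    using assms(2) unfolding rank_eq_card_nonzero_idx[OF A] by auto
  then obtain k where k: "k \<in> {1..CARD('n)}" "l k = 0" unfolding nonzero_idx_def by blast
  have "p < k"
  proof (rule ccontr)
    assume "\<not> p < k"
    then show False using sorted_eigenbasisD(2)[OF A, of k p] k assms by auto
  qed
  then show ?thesis using sorted_eigenbasisD(2)[OF A, of "p+1" k] k by auto
qed

section \<open>The perturbation in the coordinates of the range\<close>

lemma le_max0: "finite S \<Longrightarrow> a \<in> S \<Longrightarrow> a \<le> max0 S"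
  by (auto simp: max0_def)

lemma max0_nonneg: "finite S \<Longrightarrow> (\<And>a. a \<in> S \<Longrightarrow> 0 \<le> a) \<Longrightarrow> 0 \<le> max0 S"
  by (auto simp: max0_def)

lemma finite_nonzero_idx: "finite (nonzero_idx TYPE('n::finite) l)"
  by (simp add: nonzero_idx_def)

lemma pert_x_bounds:
  fixes E :: "real^'n^'n"
  shows "0 \<le> pert_x E l u"
    and "i \<in> nonzero_idx TYPE('n) l \<Longrightarrow> j \<in> nonzero_idx TYPE('n) l \<Longrightarrow> \<bar>u i \<bullet> (E *v u j)\<bar> \<le> pert_x E l u"
proof -
  have fin: "finite {\<bar>u i \<bullet> (E *v u j)\<bar> | i j. i \<in> nonzero_idx TYPE('n) l \<and> j \<in> nonzero_idx TYPE('n) l}"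
    using finite_nonzero_idx[of l, where 'n='n] by (intro finite_image_set2) simp_all
  show "0 \<le> pert_x E l u" unfolding pert_x_def by (rule max0_nonneg[OF fin]) auto
  show "i \<in> nonzero_idx TYPE('n) l \<Longrightarrow> j \<in> nonzero_idx TYPE('n) l \<Longrightarrow> \<bar>u i \<bullet> (E *v u j)\<bar> \<le> pert_x E l u"
    unfolding pert_x_def by (rule le_max0[OF fin]) auto
qed

lemma pert_w_bounds:
  fixes E :: "real^'n^'n"
  assumes "transpose E = E"
  shows "0 \<le> pert_w E l u"
    and "i \<in> nonzero_idx TYPE('n) l \<Longrightarrow> norm (E *v u i) \<le> pert_w E l u"
proof -
  have eq: "u i v* E = E *v u i" for i using assms by (metis transpose_matrix_vector)
  have fin: "finite {norm (u i v* E) | i. i \<in> nonzero_idx TYPE('n) l}"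
    using finite_nonzero_idx[of l, where 'n='n] by simp
  show "0 \<le> pert_w E l u" unfolding pert_w_def by (rule max0_nonneg[OF fin]) auto
  show "i \<in> nonzero_idx TYPE('n) l \<Longrightarrow> norm (E *v u i) \<le> pert_w E l u"
    unfolding pert_w_def eq[symmetric] by (rule le_max0[OF fin]) auto
qed

text \<open>The maximum that defines \<open>pert_y\<close> runs over \<open>i < j\<close> only; the matrix \<open>E Q E\<close> is symmetric,
  so it controls all off-diagonal entries.\<close>

lemma pert_y_bounds:
  fixes E :: "real^'n^'n" and l :: "nat \<Rightarrow> real"
  defines "I \<equiv> nonzero_idx TYPE('n) l"
  assumes E: "transpose E = E" and lp: "0 < l p"
  shows "0 \<le> pert_y E l u p"
    and "i \<in> I \<Longrightarrow> j \<in> I \<Longrightarrow> i \<noteq> j \<Longrightarrow>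
      \<bar>u i \<bullet> (E *v (E *v u j - gram_cols u I *v (E *v u j)))\<bar> \<le> pert_y E l u p * l p"
proof -
  define F where "F i j = u i \<bullet> (E *v (E *v u j - gram_cols u I *v (E *v u j)))" for i j
  have eq: "u i \<bullet> ((E ** (mat 1 - gram_cols u (nonzero_idx TYPE('n) l)) ** E) *v u j) = F i j" for i j
    by (simp add: F_def I_def matrix_vector_mul_assoc[symmetric] matrix_vector_mult_diff_rdistrib)
  have F: "F i j = (E *v u i) \<bullet> (E *v u j) - (E *v u i) \<bullet> (gram_cols u I *v (E *v u j))" for i j
    unfolding F_def by (subst symmetric_matrix_inner[OF E, symmetric]) (rule inner_diff_right)
  have sym: "F i j = F j i" for i j
    unfolding F by (metis gram_cols_symmetric inner_commute)
  have y: "pert_y E l u p = max0 {\<bar>F i j\<bar> / l p | i j. i \<in> I \<and> j \<in> I \<and> i < j}"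
    by (simp add: pert_y_def eq I_def)
  have "finite {\<bar>F i j\<bar> / l p | i j. i \<in> I \<and> j \<in> I}"
    using finite_nonzero_idx[of l, where 'n='n] by (intro finite_image_set2) (simp_all add: I_def)
  then have fin: "finite {\<bar>F i j\<bar> / l p | i j. i \<in> I \<and> j \<in> I \<and> i < j}"
    by (rule rev_finite_subset) auto
  show "0 \<le> pert_y E l u p" unfolding y by (rule max0_nonneg[OF fin]) (use lp in auto)
  have less: "\<bar>F i j\<bar> \<le> pert_y E l u p * l p" if "i \<in> I" "j \<in> I" "i < j" for i j
  proof -
    have "\<bar>F i j\<bar> / l p \<le> pert_y E l u p" unfolding y by (rule le_max0[OF fin]) (use that in auto)
    then show ?thesis using lp by (simp add: field_simps)
  qed
  show "i \<in> I \<Longrightarrow> j \<in> I \<Longrightarrow> i \<noteq> j \<Longrightarrow>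
      \<bar>u i \<bullet> (E *v (E *v u j - gram_cols u I *v (E *v u j)))\<bar> \<le> pert_y E l u p * l p"
    using less[of i j] less[of j i] sym[of i j] by (cases "i < j") (auto simp: F_def)
qed

lemma norm_gram_cols_rows_le:
  fixes E :: "real^'n^'n" and w :: real
  assumes I: "orthonormal_on I u" and E: "transpose E = E"
    and w: "0 \<le> w" "\<And>i. i \<in> I \<Longrightarrow> norm (E *v u i) \<le> w"
  shows "norm (gram_cols u I *v (E *v v)) \<le> sqrt (card I) * w * norm v"
proof -
  have "\<bar>u i \<bullet> (E *v v)\<bar> \<le> w * norm v" if "i \<in> I" for i
  proof -
    have "\<bar>u i \<bullet> (E *v v)\<bar> \<le> norm (E *v u i) * norm v"
      by (simp add: symmetric_matrix_inner[OF E, symmetric] Cauchy_Schwarz_ineq2)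
    then show ?thesis using mult_right_mono[OF w(2)[OF that] norm_ge_zero[of v]] by simp
  qed
  then show ?thesis
    using norm_gram_cols_le_coeffs[OF I, of "w * norm v" "E *v v"] w(1) by (simp add: mult.assoc)
qed

text \<open>The operator norm of the \<open>r\<close> by \<open>r\<close> block of \<open>E\<close> is at most \<open>r\<close> times its largest entry.\<close>

lemma norm_gram_cols_entries_le:
  fixes E :: "real^'n^'n" and x :: real
  assumes I: "orthonormal_on I u" and E: "transpose E = E"
    and x: "0 \<le> x" "\<And>i j. i \<in> I \<Longrightarrow> j \<in> I \<Longrightarrow> \<bar>u i \<bullet> (E *v u j)\<bar> \<le> x"
    and a: "gram_cols u I *v a = a"
  shows "norm (gram_cols u I *v (E *v a)) \<le> card I * x * norm a"
proof -
  let ?G = "gram_cols u I"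
  have "\<bar>u i \<bullet> (E *v a)\<bar> \<le> sqrt (card I) * x * norm a" if i: "i \<in> I" for i
  proof -
    have "u i \<bullet> (E *v a) = (?G *v (E *v u i)) \<bullet> a"
      by (simp add: symmetric_matrix_inner[OF E, symmetric] gram_cols_symmetric a)
    then have "\<bar>u i \<bullet> (E *v a)\<bar> \<le> norm (?G *v (E *v u i)) * norm a"
      by (simp add: Cauchy_Schwarz_ineq2)
    also have "norm (?G *v (E *v u i)) \<le> sqrt (card I) * x"
      by (rule norm_gram_cols_le_coeffs[OF I x(1)]) (rule x(2)[OF _ i])
    finally show ?thesis by (simp add: mult_right_mono)
  qed
  then have "norm (?G *v (E *v a)) \<le> sqrt (card I) * (sqrt (card I) * x * norm a)"
    by (intro norm_gram_cols_le_coeffs[OF I]) (use x in auto)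
  then show ?thesis by (simp flip: mult.assoc)
qed

text \<open>Split \<open>v = a + b\<close> into its parts in the range and in the kernel of \<open>A\<close>. The form is at most
  \<open>(l (p + 1) + r x) \<parallel>a\<parallel>\<^sup>2 + 2 sqrt r w \<parallel>a\<parallel> \<parallel>b\<parallel> + \<parallel>E\<parallel> \<parallel>b\<parallel>\<^sup>2\<close>. The large mixed term is harmless
  because the coefficient of \<open>\<parallel>b\<parallel>\<^sup>2\<close> stays below \<open>l p\<close> by a multiple of \<open>l p\<close> and not merely
  of \<open>\<delta>\<close>, so that only \<open>r w\<^sup>2\<close> against \<open>\<delta> * l p\<close> matters.\<close>

lemma quadratic_form_complement_le:
  fixes A E :: "real^'n^'n" and l :: "nat \<Rightarrow> real" and x w \<delta> :: real
  defines "I \<equiv> nonzero_idx TYPE('n) l"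
  assumes A: "sorted_eigenbasis A l u" and E: "transpose E = E"
    and p: "p < CARD('n)" and lp: "0 < l p"
    and \<delta>: "\<delta> = l p - l (p + 1)" "0 < \<delta>" "\<delta> \<le> l p"
    and x: "0 \<le> x" "\<And>i j. i \<in> I \<Longrightarrow> j \<in> I \<Longrightarrow> \<bar>u i \<bullet> (E *v u j)\<bar> \<le> x"
    and w: "0 \<le> w" "\<And>i. i \<in> I \<Longrightarrow> norm (E *v u i) \<le> w"
    and small: "12 * (card I * x) \<le> \<delta>" "144 * (card I * w\<^sup>2) \<le> \<delta> * l p" "6 * spectral_norm E \<le> l p"
    and v: "gram_cols u {1..p} *v v = 0"
  shows "v \<bullet> ((A + E) *v v) \<le> (l p - 3/4 * \<delta>) * (norm v)\<^sup>2"
proof -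
  have I: "orthonormal_on I u" unfolding I_def by (rule nonzero_idx_orthonormal[OF A])
  define a where "a = gram_cols u I *v v"
  define b where "b = v - a"
  define W where "W = sqrt (card I) * w"
  have vab: "v = a + b" by (simp add: b_def)
  have Ga: "gram_cols u I *v a = a" by (simp add: a_def gram_cols_idem[OF I])
  have vanish: "u i \<bullet> v = 0" if "i \<in> {1..p}" for i
  proof -
    have "orthonormal_on {1..p} u"
      by (rule orthonormal_on_subset[OF sorted_eigenbasisD(1)[OF A]]) (use p in auto)
    from inner_gram_cols[OF this that, of v] show ?thesis by (simp only: v inner_zero_right)
  qed
  have "v \<bullet> (A *v v) = (\<Sum>i\<in>I. l i * (u i \<bullet> v)\<^sup>2)"
    unfolding eigenbasis_mult_nonzero_idx[OF A] inner_sum_right I_def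
    by (rule sum.cong) (simp_all add: power2_eq_square inner_commute)
  also have "\<dots> \<le> (\<Sum>i\<in>I. l (p + 1) * (u i \<bullet> v)\<^sup>2)"
  proof (rule sum_mono)
    fix i assume i: "i \<in> I"
    show "l i * (u i \<bullet> v)\<^sup>2 \<le> l (p + 1) * (u i \<bullet> v)\<^sup>2"
    proof (cases "i \<le> p")
      case True
      then show ?thesis using i vanish[of i] by (simp add: I_def nonzero_idx_def)
    next
      case False
      then have "l i \<le> l (p + 1)"
        using i by (intro sorted_eigenbasisD(2)[OF A]) (auto simp: I_def nonzero_idx_def)
      then show ?thesis by (simp add: mult_right_mono)
    qed
  qed
  also have "\<dots> = l (p + 1) * (norm a)\<^sup>2"
    by (simp add: a_def norm_gram_cols[OF I] sum_distrib_left)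
  finally have vAv: "v \<bullet> (A *v v) \<le> l (p + 1) * (norm a)\<^sup>2" .
  have compress: "a \<bullet> (E *v c) \<le> norm a * norm (gram_cols u I *v (E *v c))" for c
    using norm_cauchy_schwarz[of a "gram_cols u I *v (E *v c)"]
    by (simp add: gram_cols_symmetric[symmetric] Ga)
  have aEa: "a \<bullet> (E *v a) \<le> \<delta> / 12 * (norm a)\<^sup>2"
  proof -
    have "a \<bullet> (E *v a) \<le> norm a * (card I * x * norm a)"
      using compress[of a] norm_gram_cols_entries_le[OF I E x Ga]
      by (meson mult_left_mono norm_ge_zero order_trans)
    also have "\<dots> = card I * x * (norm a)\<^sup>2" by (simp add: power2_eq_square)
    also have "\<dots> \<le> \<delta> / 12 * (norm a)\<^sup>2" using small(1) by (intro mult_right_mono) auto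
    finally show ?thesis .
  qed
  \<comment> \<open>The arithmetic-geometric mean inequality, weighted so that each square gets the slack it can afford.\<close>
  have aEb: "2 * (a \<bullet> (E *v b)) \<le> \<delta> / 12 * (norm a)\<^sup>2 + l p / 12 * (norm b)\<^sup>2"
  proof -
    have "a \<bullet> (E *v b) \<le> norm a * (W * norm b)"
      unfolding W_def using compress[of b] norm_gram_cols_rows_le[OF I E w]
      by (meson mult_left_mono norm_ge_zero order_trans)
    moreover have "2 * (norm a * (W * norm b)) \<le> \<delta> / 12 * (norm a)\<^sup>2 + l p / 12 * (norm b)\<^sup>2"
    proof -
      have "W\<^sup>2 = card I * w\<^sup>2" by (simp add: W_def power_mult_distrib)
      then have W2: "W\<^sup>2 \<le> (\<delta> / 12) * (l p / 12)" using small(2) by simp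
      have "(norm a * (W * norm b))\<^sup>2 = W\<^sup>2 * ((norm a)\<^sup>2 * (norm b)\<^sup>2)"
        by (simp add: power_mult_distrib)
      also have "\<dots> \<le> ((\<delta> / 12) * (l p / 12)) * ((norm a)\<^sup>2 * (norm b)\<^sup>2)"
        by (rule mult_right_mono[OF W2]) simp
      also have "\<dots> = (\<delta> / 12 * (norm a)\<^sup>2) * (l p / 12 * (norm b)\<^sup>2)" by simp
      finally have "norm a * (W * norm b) \<le> sqrt ((\<delta> / 12 * (norm a)\<^sup>2) * (l p / 12 * (norm b)\<^sup>2))"
        by (rule real_le_rsqrt)
      also have "\<dots> \<le> (\<delta> / 12 * (norm a)\<^sup>2 + l p / 12 * (norm b)\<^sup>2) / 2"
        by (rule arith_geo_mean_sqrt) (use \<delta> lp in auto)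
      finally show ?thesis by simp
    qed
    ultimately show ?thesis by simp
  qed
  have bEb: "b \<bullet> (E *v b) \<le> l p / 6 * (norm b)\<^sup>2"
  proof -
    have "b \<bullet> (E *v b) \<le> norm b * (spectral_norm E * norm b)"
      using norm_cauchy_schwarz[of b "E *v b"] norm_spectral_norm[of E b]
      by (meson mult_left_mono norm_ge_zero order_trans)
    also have "\<dots> = spectral_norm E * (norm b)\<^sup>2" by (simp add: power2_eq_square)
    also have "\<dots> \<le> l p / 6 * (norm b)\<^sup>2" using small(3) by (intro mult_right_mono) auto
    finally show ?thesis .
  qed
  have "v \<bullet> (E *v v) = a \<bullet> (E *v a) + 2 * (a \<bullet> (E *v b)) + b \<bullet> (E *v b)"
    using symmetric_matrix_inner[OF E, of a b]
    unfolding vab by (simp add: matrix_vector_right_distrib inner_add_left inner_add_right inner_commute)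
  then have "v \<bullet> ((A + E) *v v) \<le> l (p + 1) * (norm a)\<^sup>2 + \<delta> / 6 * (norm a)\<^sup>2 + l p / 4 * (norm b)\<^sup>2"
    using vAv aEa aEb bEb
    by (simp add: matrix_vector_mult_add_rdistrib inner_add_right algebra_simps)
  also have "\<dots> = (l p - 5/6 * \<delta>) * (norm a)\<^sup>2 + l p / 4 * (norm b)\<^sup>2"
    by (simp add: \<delta>(1) field_simps)
  \<comment> \<open>For the coefficient of the second square, note that \<open>l p - 3/4 * \<delta> \<ge> l p / 4\<close> because \<open>\<delta> \<le> l p\<close>.\<close>
  also have "\<dots> \<le> (l p - 3/4 * \<delta>) * (norm a)\<^sup>2 + (l p - 3/4 * \<delta>) * (norm b)\<^sup>2"
    using \<delta> by (intro add_mono mult_right_mono) auto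
  also have "\<dots> = (l p - 3/4 * \<delta>) * (norm v)\<^sup>2"
    using gram_cols_pythagoras[OF I, of v] by (simp add: a_def b_def distrib_left)
  finally show ?thesis .
qed

section \<open>Approximate eigenvectors of the perturbed matrix\<close>

text \<open>An approximate eigenvector of \<open>A + E\<close> near the eigenvector \<open>u i\<close> of \<open>A\<close>. The eigenvalue
  equation for \<open>u i + z\<close> is solved exactly in the kernel of \<open>A\<close> at the unperturbed eigenvalue
  \<open>\<mu>\<^sub>0\<close>; the residual then consists of \<open>G E (u i)\<close>, of \<open>G E z\<close> up to its main multiple of
  \<open>u i\<close>, and of the effect of the shift from \<open>\<mu>\<^sub>0\<close> to \<open>\<mu>\<close> on \<open>z\<close>. The number \<open>\<sigma>\<close> is a lower
  bound for \<open>\<mu>\<^sub>0\<close> that can be shared by several eigenvectors.\<close>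

lemma corrected_eigenvector:
  fixes A E :: "real^'n^'n" and \<sigma> \<mu>\<^sub>0 x y w :: real
  assumes I: "orthonormal_on I u" and E: "transpose E = E" and i: "i \<in> I"
    and Au: "A *v u i = \<mu>\<^sub>0 *\<^sub>R u i"
    and A0: "\<And>v. gram_cols u I *v v = 0 \<Longrightarrow> A *v v = 0"
    and \<sigma>: "0 < \<sigma>" "\<sigma> \<le> \<mu>\<^sub>0" "6 * spectral_norm E \<le> \<sigma>"
    and x: "0 \<le> x" "\<And>i j. i \<in> I \<Longrightarrow> j \<in> I \<Longrightarrow> \<bar>u i \<bullet> (E *v u j)\<bar> \<le> x"
    and y: "0 \<le> y" "\<And>i j. i \<in> I \<Longrightarrow> j \<in> I \<Longrightarrow> i \<noteq> j \<Longrightarrow>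
      \<bar>u i \<bullet> (E *v (E *v u j - gram_cols u I *v (E *v u j)))\<bar> \<le> y * \<sigma>"
    and w: "0 \<le> w" "\<And>i. i \<in> I \<Longrightarrow> norm (E *v u i) \<le> w"
  obtains z \<mu> where "\<mu>\<^sub>0 \<le> \<mu>" and "norm z \<le> 6/5 * (spectral_norm E / \<sigma>)"
    and "norm ((A + E) *v (u i + z) - \<mu> *\<^sub>R (u i + z))
      \<le> sqrt (card I) * x + sqrt (card I) * y + 12/5 * (card I * w\<^sup>2 / \<sigma>) * (spectral_norm E / \<sigma>)"
proof -
  let ?G = "gram_cols u I" and ?\<epsilon> = "spectral_norm E"
  define Q where "Q v = v - ?G *v v" for v
  define q where "q = Q (E *v u i)"
  have \<mu>0: "0 < \<mu>\<^sub>0" using \<sigma> by linarith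
  have GQ: "?G *v Q v = 0" for v
    by (simp add: Q_def matrix_vector_mult_diff_distrib gram_cols_idem[OF I])
  have normQ: "norm (Q v) \<le> norm v" for v unfolding Q_def by (rule norm_gram_cols_le(2)[OF I])
  have \<epsilon>0: "0 \<le> ?\<epsilon>" by (rule spectral_norm_nonneg)
  \<comment> \<open>The equation for the correction is \<open>f z = q\<close>. It is solvable because \<open>f\<close> is bounded below,
      hence injective.\<close>
  define f where "f v = \<mu>\<^sub>0 *\<^sub>R v - Q (E *v v)" for v
  have f_lower: "5/6 * \<sigma> * norm v \<le> norm (f v)" for v
  proof -
    have "norm (Q (E *v v)) \<le> ?\<epsilon> * norm v" by (rule order_trans[OF normQ norm_spectral_norm])
    also have "\<dots> \<le> \<mu>\<^sub>0 / 6 * norm v" using \<sigma> by (intro mult_right_mono) auto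
    finally have "\<mu>\<^sub>0 * norm v - \<mu>\<^sub>0 / 6 * norm v \<le> norm (\<mu>\<^sub>0 *\<^sub>R v) - norm (Q (E *v v))"
      using \<mu>0 by simp
    also have "\<dots> \<le> norm (f v)" unfolding f_def by (rule norm_triangle_ineq2)
    finally have "5/6 * (\<mu>\<^sub>0 * norm v) \<le> norm (f v)" by simp
    moreover have "\<sigma> * norm v \<le> \<mu>\<^sub>0 * norm v" using \<sigma> by (intro mult_right_mono) auto
    ultimately show ?thesis by linarith
  qed
  have "linear f"
    by (rule linearI) (simp_all add: f_def Q_def matrix_vector_right_distrib matrix_vector_mult_scaleR
        scaleR_right_distrib scaleR_right_diff_distrib mult.commute)
  moreover have "inj f"
    unfolding linear_inj_iff_eq_0[OF \<open>linear f\<close>]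
  proof (intro allI impI)
    fix v assume "f v = 0"
    then have "\<sigma> * norm v \<le> \<sigma> * 0" using f_lower[of v] by simp
    then show "v = 0" using \<sigma>(1) by (simp only: mult_le_cancel_left_pos) simp
  qed
  ultimately have "surj f" by (intro linear_injective_imp_surjective) simp_all
  then obtain z where z: "f z = q" by (metis surjD)
  then have \<mu>z: "\<mu>\<^sub>0 *\<^sub>R z = Q (E *v z) + q" by (simp add: f_def algebra_simps)
  have "\<mu>\<^sub>0 *\<^sub>R (?G *v z) = ?G *v (\<mu>\<^sub>0 *\<^sub>R z)" by (simp only: matrix_vector_mult_scaleR)
  also have "\<dots> = 0" unfolding \<mu>z by (simp only: matrix_vector_right_distrib GQ q_def add_0)
  finally have "?G *v z = 0" using \<mu>0 by simp
  then have Az: "A *v z = 0" by (rule A0)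
  have q\<epsilon>: "norm q \<le> ?\<epsilon>"
    using order_trans[OF normQ norm_spectral_norm, of E "u i"] norm_orthonormal[OF I i]
    by (simp add: q_def)
  have qw: "norm q \<le> w" unfolding q_def by (rule order_trans[OF normQ w(2)[OF i]])
  have z_le: "norm z \<le> 6/5 * (c / \<sigma>)" if "norm q \<le> c" for c
    using f_lower[of z] that \<sigma>(1) by (simp add: z field_simps)
  \<comment> \<open>The diagonal coordinate of \<open>G E q\<close> is a square norm, hence nonnegative.\<close>
  have qq: "u i \<bullet> (E *v q) = q \<bullet> q"
  proof -
    have "u i \<bullet> (E *v q) = (E *v u i) \<bullet> q" by (simp add: symmetric_matrix_inner[OF E])
    also have "E *v u i = q + ?G *v (E *v u i)" by (simp add: q_def Q_def)
    also have "\<dots> \<bullet> q = q \<bullet> q + (E *v u i) \<bullet> (?G *v q)"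
      by (simp only: inner_add_left gram_cols_symmetric)
    also have "?G *v q = 0" by (simp only: q_def GQ)
    finally show ?thesis by simp
  qed
  \<comment> \<open>The upward shift of the approximate eigenvalue that cancels this diagonal coordinate.\<close>
  define d where "d = (q \<bullet> q) / \<mu>\<^sub>0"
  have d0: "0 \<le> d" using \<mu>0 by (simp add: d_def)
  have d_le: "d \<le> w\<^sup>2 / \<sigma>"
    unfolding d_def power2_norm_eq_inner[symmetric]
    using qw \<sigma> by (intro frac_le power_mono) auto
  \<comment> \<open>Here \<open>\<mu>\<^sub>0 G E z = G E q + rest\<close>, and \<open>offdiag\<close> is \<open>G E q\<close> without its diagonal coordinate.\<close>
  define offdiag where "offdiag = ?G *v (E *v q) - (q \<bullet> q) *\<^sub>R u i"
  define rest where "rest = ?G *v (E *v Q (E *v z))"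
  have residual: "(A + E) *v (u i + z) - (\<mu>\<^sub>0 + d) *\<^sub>R (u i + z)
      = ?G *v (E *v u i) + (1 / \<mu>\<^sub>0) *\<^sub>R offdiag + (1 / \<mu>\<^sub>0) *\<^sub>R rest - d *\<^sub>R z"
  proof -
    have "\<mu>\<^sub>0 *\<^sub>R (?G *v (E *v z)) = ?G *v (E *v (\<mu>\<^sub>0 *\<^sub>R z))"
      by (simp only: matrix_vector_mult_scaleR)
    also have "\<dots> = rest + ?G *v (E *v q)"
      unfolding \<mu>z rest_def by (simp only: matrix_vector_right_distrib)
    finally have "(1 / \<mu>\<^sub>0) *\<^sub>R (\<mu>\<^sub>0 *\<^sub>R (?G *v (E *v z)))
        = (1 / \<mu>\<^sub>0) *\<^sub>R rest + (1 / \<mu>\<^sub>0) *\<^sub>R (?G *v (E *v q))"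
      by (simp only: scaleR_right_distrib)
    then have GEz: "?G *v (E *v z) = (1 / \<mu>\<^sub>0) *\<^sub>R rest + (1 / \<mu>\<^sub>0) *\<^sub>R (?G *v (E *v q))"
      using \<mu>0 by simp
    have Eu: "E *v u i = ?G *v (E *v u i) + q" by (simp add: q_def Q_def)
    have Ez: "E *v z = ?G *v (E *v z) + (\<mu>\<^sub>0 *\<^sub>R z - q)" by (simp add: \<mu>z Q_def)
    have du: "(1 / \<mu>\<^sub>0) *\<^sub>R offdiag = (1 / \<mu>\<^sub>0) *\<^sub>R (?G *v (E *v q)) - d *\<^sub>R u i"
      by (simp add: offdiag_def d_def scaleR_right_diff_distrib)
    have "(A + E) *v (u i + z) - (\<mu>\<^sub>0 + d) *\<^sub>R (u i + z)
        = (\<mu>\<^sub>0 *\<^sub>R u i + E *v u i + E *v z) - (\<mu>\<^sub>0 + d) *\<^sub>R (u i + z)"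
      by (simp add: matrix_vector_mult_add_rdistrib matrix_vector_right_distrib Au Az)
    also have "\<dots> = ?G *v (E *v u i) + ?G *v (E *v z) - d *\<^sub>R u i - d *\<^sub>R z"
      by (subst Eu, subst Ez) (simp add: scaleR_left_distrib scaleR_right_distrib)
    also have "\<dots> = ?G *v (E *v u i) + (1 / \<mu>\<^sub>0) *\<^sub>R offdiag + (1 / \<mu>\<^sub>0) *\<^sub>R rest - d *\<^sub>R z"
      by (subst GEz, subst du) simp
    finally show ?thesis .
  qed
  have shrink: "norm ((1 / \<mu>\<^sub>0) *\<^sub>R v) \<le> norm v / \<sigma>" for v :: "real^'n"
    using \<sigma> \<mu>0 by (simp add: frac_le)
  have b1: "norm (?G *v (E *v u i)) \<le> sqrt (card I) * x"
    by (rule norm_gram_cols_le_coeffs[OF I x(1)]) (rule x(2)[OF _ i])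
  have b2: "norm ((1 / \<mu>\<^sub>0) *\<^sub>R offdiag) \<le> sqrt (card I) * y"
  proof -
    have "offdiag = ?G *v (E *v q - (q \<bullet> q) *\<^sub>R u i)"
      by (simp add: offdiag_def matrix_vector_mult_diff_distrib matrix_vector_mult_scaleR
          gram_cols_fix[OF I i])
    moreover have "\<bar>u j \<bullet> (E *v q - (q \<bullet> q) *\<^sub>R u i)\<bar> \<le> y * \<sigma>" if j: "j \<in> I" for j
    proof (cases "j = i")
      case True
      then show ?thesis
        using norm_orthonormal[OF I i] y(1) \<sigma>(1) by (simp add: inner_diff_right qq norm_eq_1)
    next
      case False
      then have "u j \<bullet> u i = 0" using I i j by (simp add: orthonormal_on_def)
      then show ?thesis using y(2)[OF j i False] by (simp add: inner_diff_right q_def Q_def)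
    qed
    ultimately have "norm offdiag \<le> sqrt (card I) * (y * \<sigma>)"
      using y(1) \<sigma>(1) norm_gram_cols_le_coeffs[OF I, of "y * \<sigma>"] by simp
    then have "norm offdiag / \<sigma> \<le> sqrt (card I) * y" using \<sigma>(1) by (simp add: field_simps)
    then show ?thesis using shrink[of offdiag] by linarith
  qed
  have card1: "1 \<le> real (card I)"
    using I i by (metis One_nat_def Suc_leI card_gt_0_iff empty_iff of_nat_1 of_nat_le_iff orthonormal_on_def)
  \<comment> \<open>A common bound for the two terms of higher order.\<close>
  define K where "K = 6/5 * (card I * w\<^sup>2 / \<sigma>) * (?\<epsilon> / \<sigma>)"
  have b3: "norm ((1 / \<mu>\<^sub>0) *\<^sub>R rest) \<le> K"
  proof -
    \<comment> \<open>Of the three factors \<open>E\<close>, the outer two act on the range of \<open>A\<close> and cost \<open>sqrt r * w\<close> and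
        \<open>w\<close>; only the middle one costs the full norm of \<open>E\<close>.\<close>
    have "norm (Q (E *v z)) \<le> ?\<epsilon> * norm z" by (rule order_trans[OF normQ norm_spectral_norm])
    also have "\<dots> \<le> ?\<epsilon> * (6/5 * (w / \<sigma>))" by (rule mult_left_mono[OF z_le[OF qw] \<epsilon>0])
    finally have "sqrt (card I) * w * norm (Q (E *v z)) \<le> sqrt (card I) * w * (?\<epsilon> * (6/5 * (w / \<sigma>)))"
      using w(1) by (intro mult_left_mono) auto
    then have "norm rest \<le> sqrt (card I) * w * (?\<epsilon> * (6/5 * (w / \<sigma>)))"
      unfolding rest_def using norm_gram_cols_rows_le[OF I E w, of "Q (E *v z)"] by linarith
    also have "\<dots> = sqrt (card I) * (6/5 * w\<^sup>2 * (?\<epsilon> / \<sigma>))" by (simp add: power2_eq_square)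
    also have "\<dots> \<le> card I * (6/5 * w\<^sup>2 * (?\<epsilon> / \<sigma>))"
      using card1 \<epsilon>0 \<sigma>(1) by (intro mult_right_mono) (auto simp: real_sqrt_le_iff' intro!: real_le_lsqrt self_le_power)
    also have "\<dots> = K * \<sigma>" using \<sigma>(1) by (simp add: K_def)
    finally have "norm rest / \<sigma> \<le> K" using \<sigma>(1) by (simp add: field_simps)
    then show ?thesis using shrink[of rest] by linarith
  qed
  have b4: "norm (d *\<^sub>R z) \<le> K"
  proof -
    \<comment> \<open>The shift already costs \<open>w\<^sup>2 / \<sigma>\<close>, so \<open>z\<close> is estimated by the norm of \<open>E\<close> here.\<close>
    have "norm (d *\<^sub>R z) = d * norm z" using d0 by simp
    also have "\<dots> \<le> w\<^sup>2 / \<sigma> * (6/5 * (?\<epsilon> / \<sigma>))"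
      using \<sigma>(1) by (intro mult_mono d_le z_le[OF q\<epsilon>]) auto
    also have "\<dots> = 1 * (w\<^sup>2 / \<sigma> * (6/5 * (?\<epsilon> / \<sigma>)))" by simp
    also have "\<dots> \<le> card I * (w\<^sup>2 / \<sigma> * (6/5 * (?\<epsilon> / \<sigma>)))"
      using card1 \<epsilon>0 \<sigma>(1) by (intro mult_right_mono) auto
    also have "\<dots> = K" by (simp add: K_def)
    finally show ?thesis .
  qed
  have "norm ((A + E) *v (u i + z) - (\<mu>\<^sub>0 + d) *\<^sub>R (u i + z))
      \<le> norm (?G *v (E *v u i)) + norm ((1 / \<mu>\<^sub>0) *\<^sub>R offdiag) + norm ((1 / \<mu>\<^sub>0) *\<^sub>R rest) + norm (d *\<^sub>R z)"
    unfolding residual by (intro norm_triangle_le norm_triangle_le_diff add_mono order_refl)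
  also have "\<dots> \<le> sqrt (card I) * x + sqrt (card I) * y + 2 * K" using b1 b2 b3 b4 by linarith
  also have "2 * K = 12/5 * (card I * w\<^sup>2 / \<sigma>) * (?\<epsilon> / \<sigma>)" by (simp add: K_def)
  finally show thesis by (intro that[of "\<mu>\<^sub>0 + d" z] z_le[OF q\<epsilon>]) (use d0 in simp_all)
qed

section \<open>The perturbation bound\<close>

theorem theorem2p1:
  fixes A E :: "real^'n^'n"
    and l l' :: "nat \<Rightarrow> real"
    and u u' :: "nat \<Rightarrow> real^'n"
    and p r :: nat
    and \<delta> :: real
  assumes "transpose A = A" and "transpose E = E"
    and "rank A = r" and "r < CARD('n)"
    and "sorted_eigenbasis A l u"
    and "sorted_eigenbasis (A + E) l' u'"
    and "1 \<le> p" and "p \<le> r"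
    and "l p > 0"
    and "\<delta> = l p - l (p + 1)" and "\<delta> > 0"
    and "\<delta> \<ge> max (12 * real r * pert_x E l u) (144 * real r * (pert_w E l u)\<^sup>2 / l p)"
  shows "spectral_norm (spectral_proj u' p - spectral_proj u p)
           \<le> 12 * sqrt (real p) * (rel_norm A E l u p / \<delta>)
             + 12 * sqrt (real p) * (spectral_norm E / l p)"
proof -
  note E = assms(2) and A = assms(5) and AE = assms(6) and lp = assms(9) and \<delta> = assms(10,11)
  define I where "I = nonzero_idx TYPE('n) l"
  define x where "x = pert_x E l u"
  define y where "y = pert_y E l u p"
  define w where "w = pert_w E l u"
  define \<eta> where "\<eta> = spectral_norm E / l p"
  define N where "N = rel_norm A E l u p"
  have r: "r = card I" using assms(3) by (simp add: I_def rank_eq_card_nonzero_idx[OF A])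
  have pn: "p < CARD('n)" using assms(4,8) by linarith
  have I: "orthonormal_on I u" unfolding I_def by (rule nonzero_idx_orthonormal[OF A])
  have x: "0 \<le> x" "\<And>i j. i \<in> I \<Longrightarrow> j \<in> I \<Longrightarrow> \<bar>u i \<bullet> (E *v u j)\<bar> \<le> x"
    unfolding x_def I_def by (rule pert_x_bounds; assumption?)+
  have w: "0 \<le> w" "\<And>i. i \<in> I \<Longrightarrow> norm (E *v u i) \<le> w"
    unfolding w_def I_def by (rule pert_w_bounds[OF E]; assumption?)+
  have y: "0 \<le> y" "\<And>i j. i \<in> I \<Longrightarrow> j \<in> I \<Longrightarrow> i \<noteq> j \<Longrightarrow>
      \<bar>u i \<bullet> (E *v (E *v u j - gram_cols u I *v (E *v u j)))\<bar> \<le> y * l p"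
    unfolding y_def I_def by (rule pert_y_bounds[OF E, where l = l and p = p], rule lp; assumption?)+
  have N: "N = sqrt (card I) * x + sqrt (card I) * y"
    using assms(3) by (simp add: N_def rel_norm_def r x_def y_def)
  have N0: "0 \<le> N" using x y by (simp add: N)
  have \<delta>_le: "\<delta> \<le> l p"
    using next_eigenvalue_nonneg[OF A _ assms(7) pn lp] assms(3,4) \<delta> by simp
  have small: "12 * (card I * x) \<le> \<delta>" "144 * (card I * w\<^sup>2) \<le> \<delta> * l p"
    using assms(12) lp by (simp_all add: r x_def w_def field_simps)
  have \<eta>0: "0 \<le> \<eta>" using lp by (simp add: \<eta>_def spectral_norm_nonneg)
  have on: "orthonormal_on {1..p} u" "orthonormal_on {1..p} u'"
    by (rule orthonormal_on_subset[OF sorted_eigenbasisD(1)], rule A AE, use pn in auto)+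
  have "spectral_norm (spectral_proj u' p - spectral_proj u p) \<le> 12 * (sqrt p * (N / \<delta> + \<eta>))"
  proof (cases "6 * spectral_norm E \<le> l p")
    \<comment> \<open>Two projections never differ by more than 2 in norm, and the right-hand side exceeds 2.\<close>
    case False
    then have "1 * 2 \<le> sqrt p * (12 * \<eta>)"
      using lp assms(7) by (intro mult_mono) (auto simp: \<eta>_def field_simps)
    moreover have "0 \<le> 12 * (sqrt p * (N / \<delta>))" using N0 \<delta> by simp
    moreover have "spectral_norm (spectral_proj u' p - spectral_proj u p) \<le> 2"
      unfolding spectral_proj_eq_gram_cols by (rule spectral_norm_proj_diff_le_2[OF on])
    moreover have "12 * (sqrt p * (N / \<delta> + \<eta>)) = 12 * (sqrt p * (N / \<delta>)) + sqrt p * (12 * \<eta>)"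
      by (simp only: distrib_left mult.left_commute)
    ultimately show ?thesis by linarith
  next
    case True
    have gap: "l' (p + 1) \<le> l p - 3/4 * \<delta>"
      by (rule eigenvalue_upper_bound[OF AE pn])
        (rule quadratic_form_complement_le[OF A E pn lp \<delta> \<delta>_le x[unfolded I_def] w[unfolded I_def]
            small[unfolded I_def] True])
    define s where "s = 2 * (N / \<delta> + \<eta>)"
    have "norm (u i - gram_cols u' {1..p} *v u i) \<le> s" if i: "i \<in> {1..p}" for i
    proof -
      have l: "l p \<le> l i" using i pn by (intro sorted_eigenbasisD(2)[OF A]) auto
      have iI: "i \<in> I" using i pn l lp by (auto simp: I_def nonzero_idx_def)
      have Au: "A *v u i = l i *\<^sub>R u i" using i pn by (intro sorted_eigenbasisD(3)[OF A]) auto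
      have A0: "A *v v = 0" if "gram_cols u I *v v = 0" for v
        using inner_gram_cols[OF I, of _ v]
        by (simp add: eigenbasis_mult_nonzero_idx[OF A] I_def[symmetric] that)
      obtain z \<mu> where \<mu>: "l i \<le> \<mu>" and z: "norm z \<le> 6/5 * \<eta>"
        and res: "norm ((A + E) *v (u i + z) - \<mu> *\<^sub>R (u i + z))
          \<le> N + 12/5 * (card I * w\<^sup>2 / l p) * \<eta>"
        using corrected_eigenvector[OF I E iI Au A0 lp l True x y w] unfolding \<eta>_def N by blast
      let ?P = "gram_cols u' {1..p}"
      have "card I * w\<^sup>2 / l p \<le> \<delta> / 144" using small(2) lp by (simp add: field_simps)
      then have "12/5 * (card I * w\<^sup>2 / l p) * \<eta> \<le> 12/5 * (\<delta> / 144) * \<eta>"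
        using \<eta>0 by (intro mult_right_mono mult_left_mono) auto
      also have "\<dots> = \<delta> * \<eta> / 60" by simp
      finally have res': "norm ((A + E) *v (u i + z) - \<mu> *\<^sub>R (u i + z)) \<le> N + \<delta> * \<eta> / 60"
        using res by linarith
      have "norm ((u i + z) - ?P *v (u i + z)) \<le> (N + \<delta> * \<eta> / 60) / (3/4 * \<delta>)"
      proof -
        have "norm ((u i + z) - ?P *v (u i + z))
            \<le> norm ((A + E) *v (u i + z) - \<mu> *\<^sub>R (u i + z)) / (3/4 * \<delta>)"
          by (rule eigenspace_residual_bound[OF AE]) (use \<delta> gap l \<mu> pn in auto)
        also have "\<dots> \<le> (N + \<delta> * \<eta> / 60) / (3/4 * \<delta>)"
          using \<delta> by (intro divide_right_mono res') auto
        finally show ?thesis .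
      qed
      also have "\<dots> = 4/3 * (N / \<delta>) + \<eta> / 45" using \<delta> by (simp add: field_simps)
      finally have proj: "norm ((u i + z) - ?P *v (u i + z)) \<le> 4/3 * (N / \<delta>) + \<eta> / 45" .
      \<comment> \<open>Undoing the correction costs at most the norm of \<open>z\<close>.\<close>
      have "u i - ?P *v u i = ((u i + z) - ?P *v (u i + z)) - (z - ?P *v z)"
        by (simp add: matrix_vector_right_distrib)
      then have "norm (u i - ?P *v u i) \<le> norm ((u i + z) - ?P *v (u i + z)) + norm (z - ?P *v z)"
        by (metis norm_triangle_ineq4)
      then have "norm (u i - ?P *v u i) \<le> 4/3 * (N / \<delta>) + \<eta> / 45 + 6/5 * \<eta>"
        using proj z norm_gram_cols_le(2)[OF on(2), of z] by linarith
      moreover have "0 \<le> N / \<delta>" using N0 \<delta> by simp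
      ultimately show ?thesis using \<eta>0 by (simp add: s_def)
    qed
    moreover have s0: "0 \<le> s" using N0 \<delta> \<eta>0 by (simp add: s_def)
    ultimately have "spectral_norm (spectral_proj u' p - spectral_proj u p) \<le> 2 * (sqrt p * s)"
      unfolding spectral_proj_eq_gram_cols
      using spectral_norm_proj_diff_le[OF on, of s] by simp
    also have "\<dots> = 4 * (sqrt p * (N / \<delta> + \<eta>))" by (simp add: s_def)
    also have "\<dots> \<le> 12 * (sqrt p * (N / \<delta> + \<eta>))"
      using N0 \<delta> \<eta>0 by (intro mult_right_mono) auto
    finally show ?thesis .
  qed
  then show ?thesis by (simp add: N_def \<eta>_def algebra_simps)
qed

end
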